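(* Let $a$ be a complex number which is not a non-positive integer, and let $n,\lambda\in\mathbb Z_{\ge0}$. Put \[ B_{n,\lambda}(z)=\sum_{i=0}^n\binom ni\frac{(-1)^i z^{n-i}}{(a)_{i+\lambda}} . \] Then $\deg_z B_{n,\lambda}=n$, and there is a polynomial $A_{n,\lambda}(z)$ with $\deg_z A_{n,\lambda}\le n+\lambda-1$ such that, as formal power series in $z$, \[ B_{n,\lambda}(z)\,{}_2F_0(a,1\mid z)-A_{n,\lambda}(z)=L_{n,\lambda}(z), \] where $\operatorname{ord}_{z=0}L_{n,\lambda}(z)=2n+\lambda$ and explicitly \[ L_{n,\lambda}(z)=(-1)^n n!\,z^{2n+\lambda}\sum_{k=0}^\infty k!\binom{n+k}{k}\binom{n+k+a+\lambda-1}{k}z^k . \]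
   Context: The Pochhammer symbol is defined by $(a)_0=1$ and $(a)_{k+1}=(a+k)(a)_k$ for $k\in\mathbb Z_{\ge0}$. The formal hypergeometric series is ${}_2F_0(a,1\mid z)=\sum_{k=0}^\infty (a)_k z^k$. For non-integer upper entry, $\binom{x}{k}=x(x-1)\cdots(x-k+1)/k!$, so that $\binom{n+k+a+\lambda-1}{k}=(n+a+\lambda)_k/k!$. $\operatorname{ord}_{z=0}$ of a formal power series is the smallest exponent with a nonzero coefficient. *)

theory Defs
  imports
    Complex_Main
    "HOL-Computational_Algebra.Computational_Algebra"
    "HOL-Library.Nonpos_Ints"
begin

text \<open>In \<open>2F0(a,1|z)\<close> the factor \<open>(1)\<^sub>k\<close> cancels the \<open>k!\<close> in the denominator.\<close>

definition hyp2F0_1 :: "complex \<Rightarrow> complex fps" where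
  "hyp2F0_1 a = Abs_fps (\<lambda>k. pochhammer a k)"

lemma hyp2F0_1_eq_fps_hypergeo: "hyp2F0_1 a = fps_hypergeo [a, 1] [] 1"
  by (simp add: hyp2F0_1_def fps_eq_iff pochhammer_fact [symmetric])

definition B_poly :: "complex \<Rightarrow> nat \<Rightarrow> nat \<Rightarrow> complex poly" where
  "B_poly a n l =
     (\<Sum>i=0..n. monom (of_nat (n choose i) * (-1) ^ i / pochhammer a (i + l)) (n - i))"

definition L_fps :: "complex \<Rightarrow> nat \<Rightarrow> nat \<Rightarrow> complex fps" where
  "L_fps a n l =
     fps_const ((-1) ^ n * fact n) * fps_X ^ (2 * n + l) *
     Abs_fps (\<lambda>k. fact k * of_nat ((n + k) choose k) *
                   ((of_nat n + of_nat k + a + of_nat l - 1) gchoose k))"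

end

theory Submission
  imports Defs
begin

text \<open>
  Multiplying \<open>\<^sub>2F\<^sub>0\<close> by \<open>B\<^bsub>n,\<lambda>\<^esub>\<close> takes an \<open>n\<close>-th finite difference: since
  \<open>(a)\<^bsub>\<lambda>+s+i\<^esub> / (a)\<^bsub>\<lambda>+i\<^esub> = (a+\<lambda>+i)\<^sub>s\<close>, the coefficient of \<open>z\<^bsup>n+\<lambda>+s\<^esup>\<close> in the product is, up to the
  sign \<open>(-1)\<^sup>n\<close>, the \<open>n\<close>-th forward difference at \<open>a + \<lambda>\<close> of the polynomial \<open>x \<mapsto> (x)\<^sub>s\<close> of degree \<open>s\<close>.
  It vanishes for \<open>s < n\<close>, which produces the gap between the truncation \<open>A\<close> and the remainder \<open>L\<close>,
  and has a closed form otherwise.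
\<close>

definition forward_difference :: "('a::semiring_1 \<Rightarrow> 'b::ab_group_add) \<Rightarrow> 'a \<Rightarrow> 'b" where
  "forward_difference f x = f (x + 1) - f x"

lemma alternating_binomial_sum_Suc:
  fixes f :: "nat \<Rightarrow> 'a::comm_ring_1"
  shows "(\<Sum>i\<le>Suc n. of_nat (Suc n choose i) * (-1) ^ i * f i) =
         (\<Sum>i\<le>n. of_nat (n choose i) * (-1) ^ i * (f i - f (Suc i)))"
proof -
  have "(\<Sum>i\<le>Suc n. of_nat (Suc n choose i) * (-1) ^ i * f i) =
        f 0 + (\<Sum>i\<le>n. of_nat (n choose Suc i) * (-1) ^ Suc i * f (Suc i))
            - (\<Sum>i\<le>n. of_nat (n choose i) * (-1) ^ i * f (Suc i))"
    by (simp add: sum.atMost_Suc_shift algebra_simps sum.distrib sum_negf sum_subtractf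
             del: sum.atMost_Suc)
  also have "f 0 + (\<Sum>i\<le>n. of_nat (n choose Suc i) * (-1) ^ Suc i * f (Suc i)) =
             (\<Sum>i\<le>Suc n. of_nat (n choose i) * (-1) ^ i * f i)"
    by (simp add: sum.atMost_Suc_shift del: sum.atMost_Suc)
  finally show ?thesis
    by (simp add: binomial_eq_0 right_diff_distrib sum_subtractf)
qed

lemma funpow_forward_difference:
  fixes f :: "'a::semiring_1 \<Rightarrow> 'b::comm_ring_1"
  shows "(forward_difference ^^ n) f x =
         (-1) ^ n * (\<Sum>i\<le>n. of_nat (n choose i) * (-1) ^ i * f (x + of_nat i))"
proof (induction n arbitrary: f)
  case (Suc n)
  have "(forward_difference ^^ Suc n) f x = (forward_difference ^^ n) (forward_difference f) x"
    by (simp only: funpow_Suc_right o_apply)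
  also have "\<dots> = (-1) ^ n * (\<Sum>i\<le>n. of_nat (n choose i) * (-1) ^ i *
                                   (f (x + of_nat (Suc i)) - f (x + of_nat i)))"
    by (simp add: Suc.IH forward_difference_def add_ac)
  also have "\<dots> = (-1) ^ Suc n * (\<Sum>i\<le>n. of_nat (n choose i) * (-1) ^ i *
                                       (f (x + of_nat i) - f (x + of_nat (Suc i))))"
    by (simp add: right_diff_distrib sum_subtractf)
  finally show ?case
    unfolding alternating_binomial_sum_Suc .
qed simp

lemma forward_difference_pochhammer:
  fixes x :: "'a::comm_ring_1"
  shows "forward_difference (\<lambda>x. pochhammer x s) x = of_nat s * pochhammer (x + 1) (s - 1)"
proof (cases s)
  case (Suc t)
  have "forward_difference (\<lambda>x. pochhammer x s) x =
        pochhammer (x + 1) t * (x + 1 + of_nat t) - x * pochhammer (x + 1) t"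
    by (simp only: forward_difference_def Suc pochhammer_rec[of x] pochhammer_Suc[of "x + 1"])
  then show ?thesis
    by (simp add: Suc algebra_simps)
qed (simp add: forward_difference_def)

lemma funpow_forward_difference_pochhammer:
  fixes x :: "'a::comm_ring_1"
  shows "(forward_difference ^^ n) (\<lambda>x. pochhammer x s) x =
         of_nat (fact n * (s choose n)) * pochhammer (x + of_nat n) (s - n)"
proof (induction n arbitrary: x)
  case (Suc n)
  have absorption: "(s - n) * (s choose n) = Suc n * (s choose Suc n)"
    by (simp only: binomial_absorb_comp binomial_absorption)
  have "(forward_difference ^^ Suc n) (\<lambda>x. pochhammer x s) x =
        of_nat (fact n * (s choose n)) *
        forward_difference (\<lambda>y. pochhammer y (s - n)) (x + of_nat n)"
    by (simp add: forward_difference_def Suc.IH algebra_simps)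
  also have "\<dots> = of_nat (fact n * ((s - n) * (s choose n))) *
                   pochhammer (x + of_nat (Suc n)) (s - Suc n)"
    by (simp add: forward_difference_pochhammer ac_simps)
  also have "fact n * ((s - n) * (s choose n)) = fact (Suc n) * (s choose Suc n)"
    unfolding absorption by (simp only: fact_Suc of_nat_id mult_ac)
  finally show ?case .
qed simp

lemma fps_of_poly_mult_nth_degree_le:
  fixes p :: "'a::semiring_0 poly"
  assumes "degree p \<le> n"
  shows "(fps_of_poly p * f) $ (n + m) = (\<Sum>i\<le>n. coeff p (n - i) * f $ (m + i))"
proof -
  have "(fps_of_poly p * f) $ (n + m) = (\<Sum>j\<le>n. coeff p j * f $ (n + m - j))"
    unfolding fps_mult_nth fps_of_poly_nth using assms
    by (intro sum.mono_neutral_right) (auto simp: coeff_eq_0)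
  also have "\<dots> = (\<Sum>i\<le>n. coeff p (n - i) * f $ (n + m - (n - i)))"
    using sum.atLeastAtMost_rev[of "\<lambda>j. coeff p j * f $ (n + m - j)" 0 n]
    by (simp add: atMost_atLeast0)
  finally show ?thesis
    by (simp add: add_ac)
qed

lemma coeff_B_poly:
  assumes "i \<le> n"
  shows "coeff (B_poly a n l) (n - i) = of_nat (n choose i) * (-1) ^ i / pochhammer a (i + l)"
proof -
  have "coeff (B_poly a n l) (n - i) =
        (\<Sum>j=0..n. if j = i then of_nat (n choose j) * (-1) ^ j / pochhammer a (j + l) else 0)"
    unfolding B_poly_def coeff_sum using assms by (intro sum.cong) auto
  then show ?thesis
    using assms by simp
qed

lemma degree_B_poly_le: "degree (B_poly a n l) \<le> n"
  unfolding B_poly_def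
  by (intro degree_sum_le) (auto intro: order.trans[OF degree_monom_le])

lemma
  assumes "a \<notin> \<int>\<^sub>\<le>\<^sub>0"
  shows B_poly_neq_0: "B_poly a n l \<noteq> 0"
    and degree_B_poly: "degree (B_poly a n l) = n"
proof -
  have "coeff (B_poly a n l) n \<noteq> 0"
    using coeff_B_poly[of 0 n a l] assms by (auto simp: pochhammer_eq_0_iff)
  then show "B_poly a n l \<noteq> 0" "degree (B_poly a n l) = n"
    using degree_B_poly_le by (auto intro: antisym le_degree)
qed

lemma B_poly_mult_hyp2F0_1_nth:
  assumes "a \<notin> \<int>\<^sub>\<le>\<^sub>0"
  shows "(fps_of_poly (B_poly a n l) * hyp2F0_1 a) $ (n + l + s) =
         (-1) ^ n * (forward_difference ^^ n) (\<lambda>x. pochhammer x s) (a + of_nat l)"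
proof -
  have pochhammer_ratio: "pochhammer a (l + s + i) / pochhammer a (i + l) =
                          pochhammer (a + of_nat l + of_nat i) s" for i
  proof -
    have "pochhammer a (i + l) \<noteq> 0"
      using assms by (auto simp: pochhammer_eq_0_iff)
    moreover have "pochhammer a (l + s + i) =
                   pochhammer a (i + l) * pochhammer (a + of_nat l + of_nat i) s"
      using pochhammer_product'[of a "i + l" s] by (simp add: add_ac)
    ultimately show ?thesis
      by simp
  qed
  have "(fps_of_poly (B_poly a n l) * hyp2F0_1 a) $ (n + l + s) =
        (\<Sum>i\<le>n. coeff (B_poly a n l) (n - i) * hyp2F0_1 a $ (l + s + i))"
    using fps_of_poly_mult_nth_degree_le[OF degree_B_poly_le] by (simp only: add.assoc)
  also have "\<dots> = (\<Sum>i\<le>n. of_nat (n choose i) * (-1) ^ i *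
                           (pochhammer a (l + s + i) / pochhammer a (i + l)))"
    by (intro sum.cong) (simp_all add: coeff_B_poly hyp2F0_1_def)
  also have "\<dots> = (-1) ^ n * (forward_difference ^^ n) (\<lambda>x. pochhammer x s) (a + of_nat l)"
    by (simp add: pochhammer_ratio funpow_forward_difference)
  finally show ?thesis .
qed

lemma L_fps_nth:
  "L_fps a n l $ (n + l + s) =
   (-1) ^ n * of_nat (fact n * (s choose n)) * pochhammer (a + of_nat l + of_nat n) (s - n)"
proof (cases "s < n")
  case False
  then obtain k where s: "s = n + k"
    by (auto simp: not_less le_iff_add)
  have "fact k * ((of_nat n + of_nat k + a + of_nat l - 1) gchoose k) =
        pochhammer (a + of_nat l + of_nat n) k"
    by (simp add: gbinomial_pochhammer' algebra_simps)
  moreover have "n + k choose k = n + k choose n"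
    using binomial_symmetric[of k "n + k"] by simp
  ultimately show ?thesis
    by (simp add: s L_fps_def mult.assoc fps_X_power_mult_nth mult_ac)
qed (simp add: L_fps_def mult.assoc fps_X_power_mult_nth)

lemma L_fps_eq_fps_X_power_mult_fps_shift:
  assumes "a \<notin> \<int>\<^sub>\<le>\<^sub>0"
  shows "L_fps a n l =
         fps_X ^ (n + l) * fps_shift (n + l) (fps_of_poly (B_poly a n l) * hyp2F0_1 a)"
proof (rule fps_ext)
  fix m
  show "L_fps a n l $ m =
        (fps_X ^ (n + l) * fps_shift (n + l) (fps_of_poly (B_poly a n l) * hyp2F0_1 a)) $ m"
  proof (cases "m < n + l")
    case True
    then show ?thesis
      by (simp add: L_fps_def mult.assoc fps_X_power_mult_nth)
  next
    case False
    then obtain s where m: "m = n + l + s"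
      by (auto simp: not_less le_iff_add)
    have "L_fps a n l $ m = (fps_of_poly (B_poly a n l) * hyp2F0_1 a) $ m"
      unfolding m L_fps_nth B_poly_mult_hyp2F0_1_nth[OF assms] funpow_forward_difference_pochhammer
      by (simp only: mult.assoc)
    then show ?thesis
      using False by (simp add: fps_X_power_mult_nth)
  qed
qed

lemma
  shows L_fps_neq_0: "L_fps a n l \<noteq> 0"
    and subdegree_L_fps: "subdegree (L_fps a n l) = 2 * n + l"
proof -
  have lowest_coeff: "L_fps a n l $ (2 * n + l) \<noteq> 0"
    by (simp add: L_fps_def mult.assoc fps_X_power_mult_nth)
  moreover have "L_fps a n l $ i = 0" if "i < 2 * n + l" for i
    using that by (simp add: L_fps_def mult.assoc fps_X_power_mult_nth)
  ultimately show "subdegree (L_fps a n l) = 2 * n + l"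
    by (intro subdegreeI)
  show "L_fps a n l \<noteq> 0"
    using lowest_coeff by auto
qed

theorem theorem2:
  fixes a :: complex and n l :: nat
  assumes "a \<notin> \<int>\<^sub>\<le>\<^sub>0"
  shows "B_poly a n l \<noteq> 0 \<and> degree (B_poly a n l) = n \<and>
    (\<exists>A :: complex poly.
       (A = 0 \<or> int (degree A) \<le> int n + int l - 1) \<and>
       fps_of_poly (B_poly a n l) * hyp2F0_1 a - fps_of_poly A = L_fps a n l) \<and>
    L_fps a n l \<noteq> 0 \<and> subdegree (L_fps a n l) = 2 * n + l"
proof (intro conjI exI)
  define P where "P = fps_of_poly (B_poly a n l) * hyp2F0_1 a"
  define A where "A = truncate_fps (n + l) P"
  show "A = 0 \<or> int (degree A) \<le> int n + int l - 1"
    using degree_truncate_fps[of "n + l" P] unfolding A_def by (cases "n + l = 0") auto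
  have "P - fps_of_poly A = fps_X ^ (n + l) * fps_shift (n + l) P"
    using fps_shift_cutoff'[of "n + l" P] by (simp add: A_def diff_eq_eq)
  then show "fps_of_poly (B_poly a n l) * hyp2F0_1 a - fps_of_poly A = L_fps a n l"
    unfolding P_def L_fps_eq_fps_X_power_mult_fps_shift[OF assms] .
qed (use assms in \<open>simp_all add: B_poly_neq_0 degree_B_poly L_fps_neq_0 subdegree_L_fps\<close>)

end
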